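(* Let $k\ge 5$ be an integer and let $A$ be a set of $k$ positive integers. Then $$\left|4^{\wedge}_{\pm}A\right|\ge 8k-15.$$ Furthermore, if $\left|4^{\wedge}_{\pm}A\right|=8k-15$, then $A=\min(A)\ast\{1,3,\ldots,2k-1\}$.
   Context: For a positive integer $h$ and a finite set of integers $A=\{a_1,\ldots,a_k\}$ (distinct elements), the restricted $h$-fold signed sumset is $h^{\wedge}_{\pm}A=\left\{\sum_{i=1}^k\lambda_i a_i:\lambda_i\in\{-1,0,1\},\ \sum_{i=1}^k|\lambda_i|=h\right\}$. For an integer $c$ and a set $S$ of integers, $c\ast S=\{cs:s\in S\}$. *)

theory Defs
  imports Main "HOL-Library.Set_Algebras"
begin

text \<open>
  The coefficients \<open>\<lambda>\<^sub>i\<close> of the listing \<open>A = {a\<^sub>1, \<dots>, a\<^sub>k}\<close> with distinct \<open>a\<^sub>i\<close> are indexed by the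
  elements of \<open>A\<close> themselves. Meant for finite \<open>A\<close>.
\<close>

definition restricted_signed_sumset :: "nat \<Rightarrow> int set \<Rightarrow> int set" where
  "restricted_signed_sumset h A =
     {(\<Sum>a\<in>A. l a * a) | l :: int \<Rightarrow> int.
        (\<forall>a\<in>A. l a \<in> {-1, 0, 1}) \<and> (\<Sum>a\<in>A. \<bar>l a\<bar>) = int h}"

end

theory Submission
  imports Defs
begin

text \<open>
  Induction on \<open>k\<close>. Let \<open>t < u < v < w\<close> be the four largest elements of \<open>A\<close>, so that all sums of \<open>A\<close>
  lie between \<open>\<plusminus>(t + u + v + w)\<close>. A new element \<open>z > w\<close> contributes the four larger sums of \<open>z\<close> and
  three of \<open>t, u, v, w\<close>, together with their negatives, hence eight new sums. If there are no
  others and \<open>A\<close> is the progression \<open>d, 3d, \<dots>\<close>, then \<open>z + s + u + v\<close>, where \<open>s\<close> is the fifth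
  largest element of \<open>A\<close>, must already be a sum of \<open>A\<close>; being a multiple of \<open>2d\<close> and at most
  \<open>t + u + v + w\<close>, it forces \<open>z = w + 2d\<close>.

  For \<open>k = 5\<close>, every set other than \<open>a, 3a, 5a, 7a, 9a\<close> has at least 13 positive sums, and thus at
  least 26 sums by symmetry.
\<close>

section \<open>Restricted signed sumsets: finiteness, symmetry, monotonicity\<close>

abbreviation (input) sums4 :: "int set \<Rightarrow> int set" where
  "sums4 \<equiv> restricted_signed_sumset 4"

lemma restricted_signed_sumsetI:
  assumes "\<forall>a\<in>A. l a \<in> {-1, 0, 1}" "(\<Sum>a\<in>A. \<bar>l a\<bar>) = int h" "x = (\<Sum>a\<in>A. l a * a)"
  shows "x \<in> restricted_signed_sumset h A"
  using assms unfolding restricted_signed_sumset_def by blast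

lemma restricted_signed_sumsetE:
  assumes "x \<in> restricted_signed_sumset h A"
  obtains l where "\<forall>a\<in>A. l a \<in> {-1, 0, 1}" "(\<Sum>a\<in>A. \<bar>l a\<bar>) = int h" "x = (\<Sum>a\<in>A. l a * a)"
  using assms unfolding restricted_signed_sumset_def by blast

lemma finite_restricted_signed_sumset:
  assumes "finite A"
  shows "finite (restricted_signed_sumset h A)"
proof (rule finite_subset)
  \<comment> \<open>Coefficients outside \<open>A\<close> are unconstrained, so they are normalised
    to 0 to leave finitely many functions.\<close>
  let ?F = "{l. \<forall>a. (a \<in> A \<longrightarrow> l a \<in> {-1, 0, 1 :: int}) \<and> (a \<notin> A \<longrightarrow> l a = 0)}"
  show "finite ((\<lambda>l. \<Sum>a\<in>A. l a * a) ` ?F)"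
    using assms by (intro finite_imageI finite_set_of_finite_funs) auto
  show "restricted_signed_sumset h A \<subseteq> (\<lambda>l. \<Sum>a\<in>A. l a * a) ` ?F"
  proof
    fix x assume "x \<in> restricted_signed_sumset h A"
    then obtain l where "\<forall>a\<in>A. l a \<in> {-1, 0, 1}" "x = (\<Sum>a\<in>A. l a * a)"
      by (rule restricted_signed_sumsetE)
    then show "x \<in> (\<lambda>l. \<Sum>a\<in>A. l a * a) ` ?F"
      by (intro image_eqI[of _ _ "\<lambda>a. if a \<in> A then l a else 0"]) (auto intro!: sum.cong)
  qed
qed

lemma restricted_signed_sumset_uminus:
  assumes "x \<in> restricted_signed_sumset h A"
  shows "- x \<in> restricted_signed_sumset h A"
proof -
  obtain l where "\<forall>a\<in>A. l a \<in> {-1, 0, 1}" "(\<Sum>a\<in>A. \<bar>l a\<bar>) = int h" "x = (\<Sum>a\<in>A. l a * a)"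
    using assms by (rule restricted_signed_sumsetE)
  then show ?thesis
    by (intro restricted_signed_sumsetI[where l = "\<lambda>a. - l a"]) (auto simp: sum_negf)
qed

lemma restricted_signed_sumset_mono:
  assumes "A \<subseteq> B" "finite B"
  shows "restricted_signed_sumset h A \<subseteq> restricted_signed_sumset h B"
proof
  fix x assume "x \<in> restricted_signed_sumset h A"
  then obtain l where "\<forall>a\<in>A. l a \<in> {-1, 0, 1}" "(\<Sum>a\<in>A. \<bar>l a\<bar>) = int h" "x = (\<Sum>a\<in>A. l a * a)"
    by (rule restricted_signed_sumsetE)
  \<comment> \<open>Extending \<open>l\<close> by 0 must preserve both the weight and the value; a
    general \<open>f\<close> treats both sums at once.\<close>
  moreover have "(\<Sum>a\<in>B. f (if a \<in> A then l a else 0) a) = (\<Sum>a\<in>A. f (l a) a)"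
    if "\<And>a. f 0 a = 0" for f :: "int \<Rightarrow> int \<Rightarrow> int"
    using assms that by (intro sum.mono_neutral_cong_right) auto
  from this[of "\<lambda>c a. \<bar>c\<bar>"] this[of "\<lambda>c a. c * a"]
  have "(\<Sum>a\<in>B. \<bar>if a \<in> A then l a else 0\<bar>) = (\<Sum>a\<in>A. \<bar>l a\<bar>)"
    "(\<Sum>a\<in>B. (if a \<in> A then l a else 0) * a) = (\<Sum>a\<in>A. l a * a)"
    by auto
  ultimately show "x \<in> restricted_signed_sumset h B"
    by (intro restricted_signed_sumsetI[where l = "\<lambda>a. if a \<in> A then l a else 0"]) auto
qed

section \<open>Fourfold sums: membership, size and divisibility\<close>

lemma four_fold_signed_sum:
  assumes "distinct [p, q, r, s]" "set [p, q, r, s] \<subseteq> A" "finite A" "set [\<alpha>, \<beta>, \<gamma>, \<delta>] \<subseteq> {-1, 1}"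
  shows "\<alpha> * p + \<beta> * q + \<gamma> * r + \<delta> * s \<in> sums4 A"
proof -
  let ?l = "(\<lambda>_. 0)(p := \<alpha>, q := \<beta>, r := \<gamma>, s := \<delta>)"
  have "\<alpha> * p + \<beta> * q + \<gamma> * r + \<delta> * s \<in> sums4 {p, q, r, s}"
    using assms(1,4) by (intro restricted_signed_sumsetI[where l = ?l]) auto
  then show ?thesis
    using restricted_signed_sumset_mono[of "{p, q, r, s}" A] assms by auto
qed

text \<open>Charge \<open>t\<close> to each unit of weight, and the excess \<open>a - t\<close> to
  each of the four top elements. The weight 4 costs \<open>4 * t\<close>, the excesses total
  \<open>u + v + w - 3 * t\<close>.\<close>

lemma four_fold_signed_sum_le:
  assumes "finite A" "x \<in> sums4 A" "\<forall>a\<in>A. a > 0"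
    and "{t, u, v, w} \<subseteq> A" "t < u" "u < v" "v < w" "\<forall>a\<in>A. a \<le> t \<or> a \<in> {u, v, w}"
  shows "x \<le> t + u + v + w"
proof -
  obtain l where l: "\<forall>a\<in>A. l a \<in> {-1, 0, 1}" "(\<Sum>a\<in>A. \<bar>l a\<bar>) = 4" "x = (\<Sum>a\<in>A. l a * a)"
    using assms(2) by (auto elim!: restricted_signed_sumsetE)
  have "x \<le> (\<Sum>a\<in>A. t * \<bar>l a\<bar> + (if a \<in> {t, u, v, w} then a - t else 0))"
    unfolding l(3)
  proof (rule sum_mono)
    fix a assume a: "a \<in> A"
    with l(1) have "l a = -1 \<or> l a = 0 \<or> l a = 1" by auto
    moreover have "a > 0" "a \<le> t \<or> a \<in> {u, v, w}" "t > 0" using a assms by auto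
    ultimately show "l a * a \<le> t * \<bar>l a\<bar> + (if a \<in> {t, u, v, w} then a - t else 0)"
      using assms(5-7) by auto
  qed
  also have "\<dots> = t * 4 + (\<Sum>a\<in>A. if a \<in> {t, u, v, w} then a - t else 0)"
    by (simp add: sum.distrib flip: sum_distrib_left l(2))
  also have "(\<Sum>a\<in>A. if a \<in> {t, u, v, w} then a - t else 0) = (\<Sum>a\<in>{t, u, v, w}. a - t)"
    using assms by (intro sum.mono_neutral_cong_right) auto
  also have "\<dots> = u + v + w - 3 * t" using assms by simp
  finally show ?thesis by simp
qed

text \<open>Modulo \<open>2 * d\<close> every element, with either sign, is congruent to
  \<open>d\<close>, and four such terms add up to \<open>4 * d\<close>.\<close>

lemma four_fold_signed_sum_dvd:
  assumes "x \<in> sums4 A" "\<forall>a\<in>A. 2 * d dvd a - d"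
  shows "2 * d dvd x"
proof -
  obtain l where l: "\<forall>a\<in>A. l a \<in> {-1, 0, 1}" "(\<Sum>a\<in>A. \<bar>l a\<bar>) = 4" "x = (\<Sum>a\<in>A. l a * a)"
    using assms(1) by (auto elim!: restricted_signed_sumsetE)
  \<comment> \<open>The factor \<open>l a - \<bar>l a\<bar>\<close> is 0 or -2, which absorbs the
    sign of the coefficient.\<close>
  have "x = (\<Sum>a\<in>A. l a * (a - d) + (l a - \<bar>l a\<bar>) * d) + (\<Sum>a\<in>A. \<bar>l a\<bar>) * d"
    unfolding l(3) sum_distrib_right by (subst sum.distrib [symmetric]) (simp add: algebra_simps)
  moreover have "2 * d dvd l a * (a - d) + (l a - \<bar>l a\<bar>) * d" if "a \<in> A" for a
    using that l(1) assms(2) by (auto simp: abs_if)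
  then have "2 * d dvd (\<Sum>a\<in>A. l a * (a - d) + (l a - \<bar>l a\<bar>) * d)"
    by (rule dvd_sum)
  moreover have "2 * d dvd 4 * d" by (simp add: dvd_def)
  ultimately show ?thesis using l(2) by simp
qed

section \<open>Adding a new largest element\<close>

context
  fixes A :: "int set" and t u v w z :: int
  assumes fin: "finite A" and pos: "\<forall>a\<in>A. a > 0"
    and top: "{t, u, v, w} \<subseteq> A" "t < u" "u < v" "v < w" "\<forall>a\<in>A. a \<le> t \<or> a \<in> {u, v, w}"
    and z: "w < z"
begin

text \<open>The four sums in \<open>N\<close> exceed every sum of \<open>A\<close>, and their
  negatives lie below every sum of \<open>A\<close>. If these eight are the only new sums, a
  positive sum below the least element \<open>z + t + u + v\<close> of \<open>N\<close> must be
  old.\<close>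

lemma card_sums4_insert:
  shows "card (sums4 (insert z A)) \<ge> card (sums4 A) + 8" (is ?le)
    and "card (sums4 (insert z A)) = card (sums4 A) + 8 \<Longrightarrow> x \<in> sums4 (insert z A) \<Longrightarrow>
      0 < x \<Longrightarrow> x < z + t + u + v \<Longrightarrow> x \<in> sums4 A" (is "PROP ?eq")
proof -
  define N where "N = {z + t + u + v, z + t + u + w, z + t + v + w, z + u + v + w}"
  define T where "T = sums4 A \<union> N \<union> uminus ` N"
  have above: "y > t + u + v + w" if "y \<in> N" for y
    using that top z by (auto simp: N_def)
  have bd: "y \<le> t + u + v + w" "- y \<le> t + u + v + w" if "y \<in> sums4 A" for y
    using four_fold_signed_sum_le[OF fin _ pos top] that restricted_signed_sumset_uminus by blast+
  have t: "t > 0" using top pos by auto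
  have N: "N \<subseteq> sums4 (insert z A)"
    using four_fold_signed_sum[of z t u v "insert z A" 1 1 1 1]
      four_fold_signed_sum[of z t u w "insert z A" 1 1 1 1]
      four_fold_signed_sum[of z t v w "insert z A" 1 1 1 1]
      four_fold_signed_sum[of z u v w "insert z A" 1 1 1 1] top z fin
    by (auto simp: N_def)
  then have sub: "T \<subseteq> sums4 (insert z A)"
    using restricted_signed_sumset_mono[of A "insert z A" 4] fin
    by (auto simp: T_def intro: restricted_signed_sumset_uminus)
  have "finite N" "card N = 4" using top z by (auto simp: N_def)
  have "sums4 A \<inter> N = {}"
    using bd above by (meson disjoint_iff not_le)
  moreover have "(sums4 A \<union> N) \<inter> uminus ` N = {}"
  proof -
    have "y \<notin> uminus ` N" if "y \<in> sums4 A" for y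
      using bd(2)[OF that] above by force
    moreover have "y \<notin> uminus ` N" if "y \<in> N" for y
      using above[OF that] above top t by force
    ultimately show ?thesis by blast
  qed
  ultimately have T: "card T = card (sums4 A) + 8"
    using \<open>card N = 4\<close> \<open>finite N\<close> fin finite_restricted_signed_sumset
    by (simp add: T_def card_Un_disjoint card_image)
  have fin': "finite (sums4 (insert z A))" using fin by (simp add: finite_restricted_signed_sumset)
  show ?le using card_mono[OF fin' sub] T by simp
  show "PROP ?eq"
  proof -
    assume "card (sums4 (insert z A)) = card (sums4 A) + 8"
      and x: "x \<in> sums4 (insert z A)" "0 < x" "x < z + t + u + v"
    then have "T = sums4 (insert z A)" using card_subset_eq[OF fin' sub] T by simp
    with x have "x \<in> T" by simp
    moreover have "x \<notin> N" using x(3) top by (auto simp: N_def)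
    moreover have "x \<notin> uminus ` N" using x(2) top t z by (auto simp: N_def)
    ultimately show ?thesis by (simp add: T_def)
  qed
qed

end

section \<open>Sets of five elements\<close>

text \<open>A certificate check: a strictly increasing chain that starts above 0 consists of
  distinct positive sums. Given explicit coefficient vectors, only linear inequalities between
  neighbours remain.\<close>

lemma card_pos_sums4_ge:
  fixes a b c d e :: int
  assumes ord: "0 < a" "a < b" "b < c" "c < d" "d < e"
    and len: "length cs = n"
    and coeffs: "\<forall>(\<alpha>, \<beta>, \<gamma>, \<delta>, \<epsilon>)\<in>set cs. {\<alpha>, \<beta>, \<gamma>, \<delta>, \<epsilon>} \<subseteq> {-1, 0, 1} \<and>
      \<bar>\<alpha>\<bar> + \<bar>\<beta>\<bar> + \<bar>\<gamma>\<bar> + \<bar>\<delta>\<bar> + \<bar>\<epsilon>\<bar> = 4"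
    and chain: "successively (<)
      (0 # map (\<lambda>(\<alpha>, \<beta>, \<gamma>, \<delta>, \<epsilon>). \<alpha>*a + \<beta>*b + \<gamma>*c + \<delta>*d + \<epsilon>*e) cs)"
  shows "n \<le> card {x \<in> sums4 {a, b, c, d, e}. 0 < x}"
proof -
  let ?f = "\<lambda>(\<alpha>, \<beta>, \<gamma>, \<delta>, \<epsilon>). \<alpha>*a + \<beta>*b + \<gamma>*c + \<delta>*d + \<epsilon>*e"
  have sorted: "sorted_wrt (<) (0 # map ?f cs)"
    using chain by (simp only: successively_conv_sorted_wrt transp_on_less)
  have mem: "?f q \<in> sums4 {a, b, c, d, e}" if "q \<in> set cs" for q
  proof -
    obtain \<alpha> \<beta> \<gamma> \<delta> \<epsilon> where "q = (\<alpha>, \<beta>, \<gamma>, \<delta>, \<epsilon>)" by (cases q)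
    then show ?thesis using that coeffs ord
      by (intro restricted_signed_sumsetI
          [where l = "(\<lambda>_. 0)(a := \<alpha>, b := \<beta>, c := \<gamma>, d := \<delta>, e := \<epsilon>)"]) auto
  qed
  have "set (map ?f cs) \<subseteq> {x \<in> sums4 {a, b, c, d, e}. 0 < x}"
    using sorted mem by auto
  then have le: "card (set (map ?f cs)) \<le> card {x \<in> sums4 {a, b, c, d, e}. 0 < x}"
    by (intro card_mono) (simp_all add: finite_restricted_signed_sumset)
  have "distinct (map ?f cs)"
    using sorted by (simp add: strict_sorted_iff)
  then show ?thesis
    using le by (simp only: distinct_card length_map len)
qed

text \<open>
  The case distinction and the increasing chains of 13 positive sums, given by their coefficient
  vectors, were found by a computer search. Only in case \<open>c6\<close> does the excluded progression
  satisfy the constraints, so that \<open>ne\<close> is needed there.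
\<close>

lemma card_pos_sums4_five:
  fixes a b c d e :: int
  assumes ord: "0 < a" "a < b" "b < c" "c < d" "d < e"
    and ne: "\<not> (b = 3*a \<and> c = 5*a \<and> d = 7*a \<and> e = 9*a)"
  shows "13 \<le> card {x \<in> sums4 {a, b, c, d, e}. 0 < x}"
proof -
  consider
    (c1) "c < 2*b - a" "c \<le> a + b"
    | (c2) "c < 2*b - a" "c > a + b"
    | (c3) "c \<ge> 2*b - a" "d < 2*a + c" "d \<le> b + c - a"
    | (c4) "c \<ge> 2*b - a" "d < 2*a + c" "d > b + c - a"
    | (c5) "c \<ge> 2*b - a" "d = 2*a + c" "c < 2*a + b"
    | (c6) "c \<ge> 2*b - a" "d = 2*a + c" "c \<ge> 2*a + b" "e \<le> a + b + c"
    | (c7) "c \<ge> 2*b - a" "d = 2*a + c" "c \<ge> 2*a + b" "e > a + b + c"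
    | (c8) "c \<ge> 2*b - a" "d > 2*a + c" "d \<le> a + b + c"
    | (c9) "c \<ge> 2*b - a" "d > 2*a + c" "d > a + b + c"
    by (meson linorder_less_linear linorder_not_less)
  then show ?thesis
  proof cases
    case c1
    show ?thesis
      by (rule card_pos_sums4_ge[OF ord, where
          cs = "[(-1, 1, 0, -1, 1), (-1, 0, 1, -1, 1), (1, 1, 0, -1, 1), (1, 0, 1, -1, 1), (1, -1, 1, 0, 1),
            (1, -1, 0, 1, 1), (0, 1, -1, 1, 1), (0, -1, 1, 1, 1), (-1, 1, 0, 1, 1), (-1, 0, 1, 1, 1),
            (1, 1, 0, 1, 1), (1, 0, 1, 1, 1), (0, 1, 1, 1, 1)]"])
        (use ord c1 in auto)
  next
    case c2
    show ?thesis
      by (rule card_pos_sums4_ge[OF ord, where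
          cs = "[(0, -1, 1, -1, 1), (-1, 1, 0, -1, 1), (1, 1, 0, -1, 1), (1, 1, -1, 0, 1), (-1, -1, 1, 0, 1),
            (1, -1, 1, 0, 1), (1, -1, 0, 1, 1), (0, 1, -1, 1, 1), (0, -1, 1, 1, 1), (-1, 1, 0, 1, 1),
            (1, 1, 0, 1, 1), (1, 0, 1, 1, 1), (0, 1, 1, 1, 1)]"])
        (use ord c2 in auto)
  next
    case c3
    show ?thesis
      by (rule card_pos_sums4_ge[OF ord, where
          cs = "[(-1, 1, -1, 1, 0), (-1, 1, -1, 0, 1), (0, -1, -1, 1, 1), (-1, 0, -1, 1, 1), (-1, -1, 0, 1, 1),
            (1, -1, 1, 0, 1), (1, -1, 0, 1, 1), (-1, 1, 1, 0, 1), (-1, 1, 0, 1, 1), (1, 1, 1, 0, 1),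
            (1, 1, 0, 1, 1), (1, 0, 1, 1, 1), (0, 1, 1, 1, 1)]"])
        (use ord c3 in auto)
  next
    case c4
    show ?thesis
      by (rule card_pos_sums4_ge[OF ord, where
          cs = "[(1, -1, -1, 1, 0), (-1, 1, -1, 1, 0), (-1, 1, -1, 0, 1), (1, 1, 0, -1, 1), (1, 0, 1, -1, 1),
            (0, 1, 1, -1, 1), (1, 0, -1, 1, 1), (0, 1, -1, 1, 1), (-1, 1, 0, 1, 1), (1, 1, 1, 0, 1),
            (1, 1, 0, 1, 1), (1, 0, 1, 1, 1), (0, 1, 1, 1, 1)]"])
        (use ord c4 in auto)
  next
    case c5
    show ?thesis
      by (rule card_pos_sums4_ge[OF ord, where
          cs = "[(-1, 0, 1, -1, 1), (-1, 1, -1, 0, 1), (1, 0, 1, -1, 1), (0, 1, 1, -1, 1), (-1, 0, -1, 1, 1),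
            (-1, -1, 0, 1, 1), (1, 0, -1, 1, 1), (0, 1, -1, 1, 1), (-1, 1, 0, 1, 1), (-1, 0, 1, 1, 1),
            (1, 1, 0, 1, 1), (1, 0, 1, 1, 1), (0, 1, 1, 1, 1)]"])
        (use ord c5 in auto)
  next
    case c6
    \<comment> \<open>This is the comparison of the fourth and fifth sums of the chain. If it fails,
      then \<open>3*c - 2*b \<le> e \<le> a + b + c\<close>, so \<open>2*c \<le> a + 3*b\<close>;
      adding the two lower bounds on \<open>c\<close> gives the reverse. Hence all these bounds are
      equalities, which yields the progression.\<close>
    have "2*a + 2*b + e < 2*c + d"
    proof (rule ccontr)
      assume "\<not> ?thesis"
      then have "b = 3*a" "c = 5*a" "d = 7*a" "e = 9*a" using ord c6 by linarith+
      then show False using ne by simp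
    qed
    show ?thesis
      by (rule card_pos_sums4_ge[OF ord, where
          cs = "[(1, 1, 0, 1, -1), (-1, 1, -1, 1, 0), (1, 1, -1, 1, 0), (1, 1, -1, 0, 1), (-1, -1, 1, 1, 0),
            (1, -1, 1, 1, 0), (-1, -1, 0, 1, 1), (1, -1, 0, 1, 1), (1, 1, 1, 1, 0), (-1, 1, 0, 1, 1),
            (1, 1, 0, 1, 1), (1, 0, 1, 1, 1), (0, 1, 1, 1, 1)]"])
        (use ord c6 \<open>2*a + 2*b + e < 2*c + d\<close> in auto)
  next
    case c7
    show ?thesis
      by (rule card_pos_sums4_ge[OF ord, where
          cs = "[(-1, -1, -1, 0, 1), (1, -1, -1, 0, 1), (0, -1, 1, -1, 1), (-1, 0, 1, -1, 1), (1, 0, 1, -1, 1),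
            (-1, 0, -1, 1, 1), (1, 0, -1, 1, 1), (0, 1, -1, 1, 1), (-1, 1, 1, 0, 1), (-1, 1, 0, 1, 1),
            (1, 1, 0, 1, 1), (1, 0, 1, 1, 1), (0, 1, 1, 1, 1)]"])
        (use ord c7 in auto)
  next
    case c8
    show ?thesis
      by (rule card_pos_sums4_ge[OF ord, where
          cs = "[(-1, 1, 0, -1, 1), (1, 1, 0, -1, 1), (-1, 1, -1, 0, 1), (1, 1, -1, 0, 1), (0, -1, -1, 1, 1),
            (-1, 0, -1, 1, 1), (-1, -1, 0, 1, 1), (-1, 1, 1, 0, 1), (1, 1, 1, 0, 1), (-1, 1, 0, 1, 1),
            (-1, 0, 1, 1, 1), (1, 0, 1, 1, 1), (0, 1, 1, 1, 1)]"])
        (use ord c8 in auto)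
  next
    case c9
    show ?thesis
      by (rule card_pos_sums4_ge[OF ord, where
          cs = "[(-1, -1, -1, 1, 0), (1, -1, -1, 1, 0), (-1, 1, -1, 1, 0), (-1, 1, -1, 0, 1), (1, 1, -1, 0, 1),
            (0, -1, -1, 1, 1), (-1, 0, -1, 1, 1), (1, 0, -1, 1, 1), (0, 1, -1, 1, 1), (-1, 1, 0, 1, 1),
            (1, 1, 0, 1, 1), (1, 0, 1, 1, 1), (0, 1, 1, 1, 1)]"])
        (use ord c9 in auto)
  qed
qed

lemma card_eq_pos_part:
  fixes S :: "int set"
  assumes "finite S" "\<And>x. x \<in> S \<Longrightarrow> - x \<in> S"
  shows "card S = 2 * card {x \<in> S. 0 < x} + (if 0 \<in> S then 1 else 0)"
proof -
  let ?P = "{x \<in> S. 0 < x}"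
  have "S = ?P \<union> uminus ` ?P \<union> (if 0 \<in> S then {0} else {})"
    using assms(2) by (auto simp: image_iff) (metis add.inverse_inverse neg_0_less_iff_less neqE)+
  moreover have "?P \<inter> uminus ` ?P = {}" "(?P \<union> uminus ` ?P) \<inter> (if 0 \<in> S then {0} else {}) = {}" by auto
  ultimately have "card S = card ?P + card (uminus ` ?P) + card (if 0 \<in> S then {0} else {} :: int set)"
    using \<open>finite S\<close> by (metis (no_types, lifting) card_Un_disjoint finite_Un)
  then show ?thesis by (simp add: card_image)
qed

text \<open>Counting from 0 turns an increase of \<open>k\<close> by one into the insertion of one
  element.\<close>

definition odd_multiples :: "int \<Rightarrow> nat \<Rightarrow> int set" where
  "odd_multiples d k = (\<lambda>i. d * (2 * int i + 1)) ` {..<k}"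

lemma odd_multiples_Suc: "odd_multiples d (Suc k) = insert (d * (2 * int k + 1)) (odd_multiples d k)"
  by (simp add: odd_multiples_def lessThan_Suc)

text \<open>The progression has 0 and at least 12 positive sums, so at least 25 sums by symmetry;
  any other set has at least 26.\<close>

lemma sums4_base:
  fixes a b c d e :: int
  assumes ord: "0 < a" "a < b" "b < c" "c < d" "d < e"
  defines "S \<equiv> sums4 {a, b, c, d, e}"
  shows "25 \<le> card S" "card S = 25 \<Longrightarrow> {a, b, c, d, e} = odd_multiples a 5"
proof -
  have S: "card S = 2 * card {x \<in> S. 0 < x} + (if 0 \<in> S then 1 else 0)"
    unfolding S_def by (intro card_eq_pos_part finite_restricted_signed_sumset
        restricted_signed_sumset_uminus) auto
  have *: "25 \<le> card S \<and> (card S = 25 \<longrightarrow> {a, b, c, d, e} = odd_multiples a 5)"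
  proof (cases "b = 3*a \<and> c = 5*a \<and> d = 7*a \<and> e = 9*a")
    case True
    then have "a - b - d + e = 0" by simp
    then have "0 \<in> S"
      using four_fold_signed_sum[of a b d e "{a, b, c, d, e}" 1 "-1" "-1" 1] ord by (simp add: S_def)
    moreover have "12 \<le> card {x \<in> S. 0 < x}"
      unfolding S_def
      \<comment> \<open>For the progression these twelve sums are \<open>2*a\<close>,
        \<open>4*a\<close>, ..., \<open>24*a\<close>.\<close>
      by (rule card_pos_sums4_ge[OF ord, where
          cs = "[(1, 1, 1, -1, 0), (-1, 1, -1, 1, 0), (1, 1, -1, 1, 0), (1, 1, -1, 0, 1), (1, -1, 1, 1, 0),
            (-1, -1, 0, 1, 1), (1, -1, 0, 1, 1), (1, 1, 1, 1, 0), (-1, 1, 0, 1, 1), (1, 1, 0, 1, 1),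
            (1, 0, 1, 1, 1), (0, 1, 1, 1, 1)]"])
        (use True ord in auto)
    moreover have "{a, b, c, d, e} = odd_multiples a 5"
      using True by (auto simp: odd_multiples_Suc eval_nat_numeral) (auto simp: odd_multiples_def)
    ultimately show ?thesis using S by simp
  next
    case False
    then show ?thesis using card_pos_sums4_five[OF ord] S by (simp add: S_def)
  qed
  then show "25 \<le> card S" "card S = 25 \<Longrightarrow> {a, b, c, d, e} = odd_multiples a 5" by auto
qed

section \<open>Splitting off largest elements and the induction\<close>

lemma obtain_max:
  fixes A :: "int set"
  assumes "finite A" "card A = Suc n"
  obtains z B where "A = insert z B" "\<forall>b\<in>B. b < z" "finite B" "card B = n"
proof
  have "A \<noteq> {}" using assms by auto
  then show "A = insert (Max A) (A - {Max A})" "card (A - {Max A}) = n"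
    using assms by (auto simp: insert_absorb)
  show "\<forall>b\<in>A - {Max A}. b < Max A"
    using assms(1) by (auto simp: less_le)
qed (use assms in auto)

lemma obtain_top_four:
  fixes A :: "int set"
  assumes "finite A" "card A = n + 4"
  obtains t u v w B where "A = insert w (insert v (insert u (insert t B)))" "t < u" "u < v" "v < w"
    "\<forall>b\<in>B. b < t" "finite B" "card B = n"
proof -
  obtain w A1 where w: "A = insert w A1" "\<forall>b\<in>A1. b < w" "finite A1" "card A1 = n + 3"
    using obtain_max[of A "n + 3"] assms by auto
  obtain v A2 where v: "A1 = insert v A2" "\<forall>b\<in>A2. b < v" "finite A2" "card A2 = n + 2"
    using obtain_max[of A1 "n + 2"] w by auto
  obtain u A3 where u: "A2 = insert u A3" "\<forall>b\<in>A3. b < u" "finite A3" "card A3 = n + 1"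
    using obtain_max[of A2 "n + 1"] v by auto
  obtain t B where t: "A3 = insert t B" "\<forall>b\<in>B. b < t" "finite B" "card B = n"
    using obtain_max[of A3 n] u by auto
  show thesis using w v u t by (intro that[of w v u t B]) auto
qed

text \<open>With \<open>k = m + 5\<close> the bound \<open>8 * k - 15\<close> becomes
  \<open>8 * m + 25\<close>, and each step of the induction adds 8. The ratio \<open>d\<close> is
  left existential here; it is identified with the minimum afterwards.\<close>

lemma sums4_lower_bound:
  assumes "finite A" "\<forall>a\<in>A. a > 0" "card A = m + 5"
  shows "8 * m + 25 \<le> card (sums4 A) \<and>
    (card (sums4 A) = 8 * m + 25 \<longrightarrow> (\<exists>d. A = odd_multiples d (m + 5)))"
  using assms
proof (induction m arbitrary: A)
  case 0
  then have "finite A" "card A = 1 + 4" by auto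
  then obtain t u v w B where A: "A = insert w (insert v (insert u (insert t B)))" "t < u" "u < v" "v < w"
    "\<forall>b\<in>B. b < t" "finite B" "card B = 1"
    by (rule obtain_top_four)
  then obtain s where "B = {s}" by (auto simp: card_1_singleton_iff)
  then have "A = {s, t, u, v, w}" "0 < s" "s < t" using A "0.prems" by auto
  then show ?case using sums4_base[of s t u v w] A(2-4) by auto
next
  case (Suc m)
  then have "card A = Suc (m + 5)" by simp
  with Suc.prems(1) obtain z B where B: "A = insert z B" "\<forall>b\<in>B. b < z" "finite B" "card B = m + 5"
    by (rule obtain_max)
  then have "card B = (m + 1) + 4" by simp
  with B(3) obtain t u v w C where "B = insert w (insert v (insert u (insert t C)))" "\<forall>c\<in>C. c < t"
    "t < u" "u < v" "v < w"
    by (rule obtain_top_four)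
  then have top: "{t, u, v, w} \<subseteq> B" "t < u" "u < v" "v < w" "\<forall>a\<in>B. a \<le> t \<or> a \<in> {u, v, w}"
    by auto
  have pos: "\<forall>b\<in>B. b > 0" using Suc.prems B by auto
  have step: "card (sums4 A) \<ge> card (sums4 B) + 8"
    unfolding B(1) using card_sums4_insert(1)[OF B(3) pos top] B(2) top by auto
  note IH = Suc.IH[OF B(3) pos B(4)]
  have "\<exists>d. A = odd_multiples d (Suc m + 5)" if "card (sums4 A) = 8 * Suc m + 25"
  proof -
    from that IH step have eq: "card (sums4 B) = 8 * m + 25" "card (sums4 A) = card (sums4 B) + 8"
      by auto
    with IH obtain d where d: "B = odd_multiples d (m + 5)" by auto
    \<comment> \<open>The five largest elements of \<open>B\<close>, now named explicitly through
      the progression, with \<open>s\<close> the fifth largest.\<close>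
    define s t u v w where "s = d * (2 * int m + 1)" and "t = s + 2 * d" and "u = t + 2 * d"
      and "v = u + 2 * d" and "w = v + 2 * d"
    have B': "B = insert w (insert v (insert u (insert t (insert s (odd_multiples d m)))))"
      unfolding d by (simp add: odd_multiples_Suc eval_nat_numeral s_def t_def u_def v_def w_def algebra_simps)
    have s: "s \<in> B" using B' by simp
    with pos have "0 < d" by (auto simp: s_def zero_less_mult_iff)
    have "\<forall>a\<in>odd_multiples d m. a \<le> s"
      using \<open>0 < d\<close> by (auto simp: odd_multiples_def s_def mult_le_cancel_left)
    then have top: "{t, u, v, w} \<subseteq> B" "t < u" "u < v" "v < w" "\<forall>a\<in>B. a \<le> t \<or> a \<in> {u, v, w}"
      using \<open>0 < d\<close> unfolding B' by (auto simp: t_def u_def v_def w_def)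
    have "w < z" using B(2) B' by simp
    \<comment> \<open>Since \<open>s < t\<close>, this sum lies below \<open>z + t + u + v\<close>,
      the least of the four large new sums.\<close>
    define x where "x = z + s + u + v"
    have "x \<in> sums4 A"
      using four_fold_signed_sum[of z s u v A 1 1 1 1] \<open>0 < d\<close> \<open>w < z\<close> Suc.prems(1) B(1) top s
      by (simp add: x_def t_def u_def v_def w_def)
    moreover have "0 < s" using s pos by blast
    ultimately have x: "x \<in> sums4 B"
      using card_sums4_insert(2)[OF B(3) pos top \<open>w < z\<close>] eq \<open>0 < d\<close> \<open>w < z\<close>
      unfolding B(1) by (simp add: x_def t_def u_def v_def w_def)
    have "x \<le> t + u + v + w"
      by (rule four_fold_signed_sum_le[OF B(3) x pos top])
    \<comment> \<open>Cancelling \<open>u + v\<close> leaves \<open>z - w \<le> t - s\<close>, and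
      \<open>t - s\<close> is \<open>2 * d\<close>.\<close>
    then have "z - w \<le> 2 * d" by (simp add: x_def t_def u_def v_def w_def)
    have "\<forall>a\<in>B. 2 * d dvd a - d"
      unfolding d by (auto simp: odd_multiples_def algebra_simps)
    then have "2 * d dvd x" using four_fold_signed_sum_dvd[OF x] by blast
    \<comment> \<open>Here \<open>s + u + v + w = 4 * s + 18 * d\<close>, a multiple of
      \<open>2 * d\<close> because \<open>s\<close> is a multiple of \<open>d\<close>.\<close>
    moreover have "x = (z - w) + 2 * d * (2 * (2 * int m + 1) + 9)"
      by (simp add: x_def s_def t_def u_def v_def w_def algebra_simps)
    ultimately have "2 * d dvd z - w" by (simp add: dvd_add_left_iff)
    with \<open>w < z\<close> have "2 * d \<le> z - w" by (intro zdvd_imp_le) auto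
    with \<open>z - w \<le> 2 * d\<close> have "z = d * (2 * int (m + 5) + 1)"
      by (simp add: s_def t_def u_def v_def w_def algebra_simps)
    then have "A = odd_multiples d (Suc m + 5)"
      unfolding B(1) d add_Suc odd_multiples_Suc by simp
    then show ?thesis ..
  qed
  then show ?case using IH step by auto
qed

theorem theorem3p1:
  fixes k :: nat and A :: "int set"
  assumes "k \<ge> 5"
    and "finite A" and "card A = k"
    and "\<forall>a\<in>A. a > 0"
  shows "int (card (restricted_signed_sumset 4 A)) \<ge> 8 * int k - 15 \<and>
    (int (card (restricted_signed_sumset 4 A)) = 8 * int k - 15 \<longrightarrow>
       A = Min A *o {2 * int i - 1 | i. 1 \<le> i \<and> i \<le> k})"
proof -
  obtain m where m: "k = m + 5" using assms(1) by (metis add.commute le_Suc_ex)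
  note bound = sums4_lower_bound[OF assms(2,4), of m]
  have "A = Min A *o {2 * int i - 1 | i. 1 \<le> i \<and> i \<le> k}" if d: "A = odd_multiples d k" for d
  proof -
    \<comment> \<open>Index 0 gives \<open>d\<close> itself, which is the minimum because
      \<open>d\<close> is positive.\<close>
    have "d \<in> A" unfolding d using m by (auto simp: odd_multiples_def intro!: image_eqI[of _ _ 0])
    with assms(4) have "0 < d" by blast
    then have "Min A = d"
      using assms(2) \<open>d \<in> A\<close> by (intro Min_eqI) (auto simp: d odd_multiples_def)
    moreover have "{2 * int i - 1 | i. 1 \<le> i \<and> i \<le> k} = (\<lambda>i. 2 * int i + 1) ` {..<k}"
    proof (intro equalityI subsetI)
      fix x assume "x \<in> {2 * int i - 1 | i. 1 \<le> i \<and> i \<le> k}"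
      then obtain i where "x = 2 * int i - 1" "1 \<le> i" "i \<le> k" by blast
      then show "x \<in> (\<lambda>i. 2 * int i + 1) ` {..<k}"
        \<comment> \<open>The shift passes from indices 1 to \<open>k\<close> to indices below
          \<open>k\<close>; \<open>1 \<le> i\<close> keeps the natural subtraction exact.\<close>
        by (intro image_eqI[of _ _ "i - 1"]) auto
    next
      fix x assume "x \<in> (\<lambda>i. 2 * int i + 1) ` {..<k}"
      then obtain i where "x = 2 * int (Suc i) - 1" "i < k" by auto
      then show "x \<in> {2 * int i - 1 | i. 1 \<le> i \<and> i \<le> k}" by fastforce
    qed
    ultimately show ?thesis
      by (simp add: d odd_multiples_def elt_set_times_def image_image image_iff) blast
  qed
  with bound show ?thesis using assms(3) m by auto
qed

end
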